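(* For every extended directed co-graph $G$, $\mathrm{dpw}(G)=\mathrm{dtw}(G)$.
   Context: Digraphs are finite, without loops or multiple arcs. For vertex-disjoint digraphs $G_1,\ldots,G_k$: the series composition $G_1\otimes\cdots\otimes G_k$ is their disjoint union plus all arcs in both directions between vertices of $G_i$ and $G_j$ for all $i\ne j$; a directed union $G_1\ominus\cdots\ominus G_k$ is any digraph obtained from their disjoint union by adding some (possibly none or all) arcs from vertices of $G_i$ to vertices of $G_j$ with $i<j$. Extended directed co-graphs: every single-vertex digraph is one, and if $G_1,\ldots,G_k$ are vertex-disjoint extended directed co-graphs then every directed union of them and their series composition are extended directed co-graphs. Directed path-width: a directed path-decomposition of $G=(V,E)$ is a sequence $(X_1,\ldots,X_r)$ of subsets of $V$ with $\bigcup X_i=V$, for each arc $(u,v)$ some $i\le j$ with $u\in X_i,v\in X_j$, and for each vertex the bags containing it having consecutive indices; width $\max|X_i|-1$; $\mathrm{dpw}(G)$ is the minimum width. Directed tree-width: for $Z\subseteq V$, $S\subseteq V$ is $Z$-normal if no directed walk in $G-Z$ with first and last vertex in $S$ uses a vertex of $G-(Z\cup S)$. A directed tree-decomposition is $(T,\mathcal{X},\mathcal{W})$ with $T=(V_T,E_T)$ an out-tree (rooted, arcs directed away from root; $u\le v$ means a directed path of $\ge0$ arcs from $u$ to $v$), $\mathcal{X}=\{X_e:e\in E_T\}$, $\mathcal{W}=\{W_r:r\in V_T\}$ subsets of $V$, such that $\mathcal{W}$ partitions $V$ into nonempty sets and for each $(u,v)\in E_T$ the set $\bigcup\{W_r: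 v\le r\}$ is $X_{(u,v)}$-normal; width $\max_r|W_r\cup\bigcup_{e\sim r}X_e|-1$ ($e\sim r$: $r$ is an end of $e$); $\mathrm{dtw}(G)$ is the minimum width. *)

theory Defs
  imports Main
begin

text \<open>A digraph is a pair (V, E) of a vertex set and an arc set.\<close>
type_synonym 'a digraph = "'a set \<times> ('a \<times> 'a) set"

definition digraph :: "'a digraph \<Rightarrow> bool" where
  "digraph G \<longleftrightarrow> finite (fst G) \<and> snd G \<subseteq> fst G \<times> fst G \<and> (\<forall>v. (v, v) \<notin> snd G)"

text \<open>Pairwise vertex-disjointness of a list of digraphs.\<close>
definition vdisjoint :: "'a digraph list \<Rightarrow> bool" where
  "vdisjoint Gs \<longleftrightarrow> (\<forall>i<length Gs. \<forall>j<length Gs. i \<noteq> j \<longrightarrow> fst (Gs ! i) \<inter> fst (Gs ! j) = {})"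

definition disj_union_V :: "'a digraph list \<Rightarrow> 'a set" where
  "disj_union_V Gs = (\<Union>i<length Gs. fst (Gs ! i))"

definition disj_union_E :: "'a digraph list \<Rightarrow> ('a \<times> 'a) set" where
  "disj_union_E Gs = (\<Union>i<length Gs. snd (Gs ! i))"

text \<open>Series composition G_1 (x) ... (x) G_k.\<close>
definition series_comp :: "'a digraph list \<Rightarrow> 'a digraph" where
  "series_comp Gs = (disj_union_V Gs,
     disj_union_E Gs \<union> {(u, v). \<exists>i<length Gs. \<exists>j<length Gs. i \<noteq> j \<and> u \<in> fst (Gs ! i) \<and> v \<in> fst (Gs ! j)})"

text \<open>H is a directed union G_1 (-) ... (-) G_k.\<close>
definition is_directed_union :: "'a digraph \<Rightarrow> 'a digraph list \<Rightarrow> bool" where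
  "is_directed_union H Gs \<longleftrightarrow> (\<exists>A. A \<subseteq> {(u, v). \<exists>i<length Gs. \<exists>j<length Gs. i < j \<and> u \<in> fst (Gs ! i) \<and> v \<in> fst (Gs ! j)}
      \<and> H = (disj_union_V Gs, disj_union_E Gs \<union> A))"

inductive ext_dicograph :: "'a digraph \<Rightarrow> bool" where
  single: "ext_dicograph ({v}, {})"
| dunion: "\<lbrakk>Gs \<noteq> []; vdisjoint Gs; \<forall>G\<in>set Gs. ext_dicograph G; is_directed_union H Gs\<rbrakk>
           \<Longrightarrow> ext_dicograph H"
| series: "\<lbrakk>Gs \<noteq> []; vdisjoint Gs; \<forall>G\<in>set Gs. ext_dicograph G\<rbrakk>
           \<Longrightarrow> ext_dicograph (series_comp Gs)"

subsection \<open>Directed path-width\<close>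

definition is_dpd :: "'a digraph \<Rightarrow> 'a set list \<Rightarrow> bool" where
  "is_dpd G Xs \<longleftrightarrow>
     (\<forall>i<length Xs. Xs ! i \<subseteq> fst G)
   \<and> (\<Union>i<length Xs. Xs ! i) = fst G
   \<and> (\<forall>(u, v)\<in>snd G. \<exists>i<length Xs. \<exists>j<length Xs. i \<le> j \<and> u \<in> Xs ! i \<and> v \<in> Xs ! j)
   \<and> (\<forall>v i j k. i \<le> j \<and> j \<le> k \<and> k < length Xs \<and> v \<in> Xs ! i \<and> v \<in> Xs ! k \<longrightarrow> v \<in> Xs ! j)"

definition dpd_width :: "'a set list \<Rightarrow> nat" where
  "dpd_width Xs = Max (card ` set Xs) - 1"

definition dpw :: "'a digraph \<Rightarrow> nat" where
  "dpw G = (LEAST w. \<exists>Xs. Xs \<noteq> [] \<and> is_dpd G Xs \<and> dpd_width Xs = w)"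

subsection \<open>Directed tree-width\<close>

text \<open>Directed walks: nonempty vertex lists with consecutive vertices joined by arcs.\<close>
definition is_walk :: "('a \<times> 'a) set \<Rightarrow> 'a list \<Rightarrow> bool" where
  "is_walk E w \<longleftrightarrow> w \<noteq> [] \<and> (\<forall>i. Suc i < length w \<longrightarrow> (w ! i, w ! Suc i) \<in> E)"

text \<open>S is Z-normal in G: no directed walk in G - Z with first and last vertex in S
  uses a vertex of G - (Z \<union> S).\<close>
definition normal :: "'a digraph \<Rightarrow> 'a set \<Rightarrow> 'a set \<Rightarrow> bool" where
  "normal G Z S \<longleftrightarrow> \<not> (\<exists>w. is_walk (snd G) w \<and> set w \<subseteq> fst G - Z
        \<and> hd w \<in> S \<and> last w \<in> S \<and> (\<exists>x\<in>set w. x \<notin> Z \<union> S))"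

text \<open>Out-trees (arborescences) with node set VT and arc set ET.\<close>
definition out_tree :: "nat set \<Rightarrow> (nat \<times> nat) set \<Rightarrow> bool" where
  "out_tree VT ET \<longleftrightarrow> finite VT \<and> ET \<subseteq> VT \<times> VT \<and>
     (\<exists>root\<in>VT. (\<forall>u. (u, root) \<notin> ET)
        \<and> (\<forall>v\<in>VT. v \<noteq> root \<longrightarrow> (\<exists>!u. (u, v) \<in> ET))
        \<and> (\<forall>v\<in>VT. (root, v) \<in> ET\<^sup>*))"

definition is_dtd :: "'a digraph \<Rightarrow> nat set \<Rightarrow> (nat \<times> nat) set
     \<Rightarrow> (nat \<times> nat \<Rightarrow> 'a set) \<Rightarrow> (nat \<Rightarrow> 'a set) \<Rightarrow> bool" where
  "is_dtd G VT ET X W \<longleftrightarrow> out_tree VT ET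
   \<and> (\<forall>e\<in>ET. X e \<subseteq> fst G)
   \<and> (\<forall>r\<in>VT. W r \<subseteq> fst G \<and> W r \<noteq> {})
   \<and> (\<forall>r\<in>VT. \<forall>s\<in>VT. r \<noteq> s \<longrightarrow> W r \<inter> W s = {})
   \<and> (\<Union>r\<in>VT. W r) = fst G
   \<and> (\<forall>(u, v)\<in>ET. normal G (X (u, v)) (\<Union>{W r | r. r \<in> VT \<and> (v, r) \<in> ET\<^sup>*}))"

definition dtd_width :: "nat set \<Rightarrow> (nat \<times> nat) set
     \<Rightarrow> (nat \<times> nat \<Rightarrow> 'a set) \<Rightarrow> (nat \<Rightarrow> 'a set) \<Rightarrow> nat" where
  "dtd_width VT ET X W =
     Max ((\<lambda>r. card (W r \<union> \<Union>{X e | e. e \<in> ET \<and> (fst e = r \<or> snd e = r)})) ` VT) - 1"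

definition dtw :: "'a digraph \<Rightarrow> nat" where
  "dtw G = (LEAST w. \<exists>VT ET X W. is_dtd G VT ET X W \<and> dtd_width VT ET X W = w)"

end

theory Submission
  imports Defs
begin

text \<open>A path-decomposition is turned into a tree-decomposition on a path by sorting the vertices
  according to their first bag. For the converse, a tree-decomposition restricts to the parts of a
  directed union, and path-decompositions of the parts are concatenated. In a series composition
  with vertex set \<open>V\<close> and parts \<open>V\<^sub>i\<close>, walks of length two show that every tree arc with label \<open>Z\<close>
  and vertex set \<open>S\<close> below it satisfies \<open>S \<subseteq> Z\<close>, \<open>S \<union> Z = V\<close> or \<open>V - V\<^sub>i \<subseteq> Z\<close> for some \<open>i\<close>. Arcs of the first
  two kinds can be contracted. If none are left, then some bag is \<open>V\<close>, or all bags contain the same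
  \<open>V - V\<^sub>i\<close>, and the problem is reduced to the part \<open>V\<^sub>i\<close>.\<close>

section \<open>Decompositions with bounded bags and their restriction to subgraphs\<close>

text \<open>The bound is on bag sizes instead of the width, so that adding or removing a vertex set
  shifts it without the \<open>- 1\<close> of the width.\<close>

definition dpd_bounded :: "'a digraph \<Rightarrow> nat \<Rightarrow> bool" where
  "dpd_bounded G k \<longleftrightarrow> (\<exists>Xs. Xs \<noteq> [] \<and> is_dpd G Xs \<and> (\<forall>X\<in>set Xs. card X \<le> k))"

text \<open>The part of a tree-decomposition with bags of size at most \<open>k\<close> below an arc labelled \<open>Z\<close>;
  \<open>S\<close> is the union of the blocks below that arc and \<open>C\<close> lists the pairs \<open>(Z', S')\<close> of the child arcs.
  Empty and overlapping blocks are allowed, so that the notion is inherited by subgraphs;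
  a whole decomposition is the case \<open>Z = {}\<close>, \<open>S = fst G\<close>.\<close>
inductive tree_dec :: "'a digraph \<Rightarrow> nat \<Rightarrow> 'a set \<Rightarrow> 'a set \<Rightarrow> bool" for G k where
  node: "\<lbrakk>W \<subseteq> fst G; Z \<subseteq> fst G;
          \<And>Z' S'. (Z', S') \<in> C \<Longrightarrow> normal G Z' S' \<and> tree_dec G k Z' S';
          S = W \<union> \<Union>(snd ` C);
          card (W \<union> Z \<union> \<Union>(fst ` C)) \<le> k\<rbrakk> \<Longrightarrow> tree_dec G k Z S"

lemma tree_dec_subset: "tree_dec G k Z S \<Longrightarrow> Z \<subseteq> fst G \<and> S \<subseteq> fst G"
proof (induction rule: tree_dec.induct)
  case (node W Z C S)
  have "snd c \<subseteq> fst G" if "c \<in> C" for c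
    using node.IH[of "fst c" "snd c"] that by simp
  then show ?case using node.hyps(1-3) by blast
qed

lemma bag_subset:
  assumes "W \<subseteq> fst G" "Z \<subseteq> fst G" "\<And>Z' S'. (Z', S') \<in> C \<Longrightarrow> tree_dec G k Z' S'"
  shows "W \<union> Z \<union> \<Union>(fst ` C) \<subseteq> fst G"
proof -
  have "fst c \<subseteq> fst G" if "c \<in> C" for c
    using assms(3)[of "fst c" "snd c"] tree_dec_subset[of G k "fst c" "snd c"] that by simp
  then show ?thesis using assms(1,2) by blast
qed

text \<open>A nonempty \<open>S\<close> forces a nonempty block somewhere, hence a nonempty bag.
  Positivity is used later to see that a subtraction such as \<open>k - card U\<close> has not been
  truncated.\<close>

lemma tree_dec_pos:
  assumes "tree_dec G k Z S" "finite (fst G)" "S \<noteq> {}"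
  shows "0 < k"
  using assms
proof (induction rule: tree_dec.induct)
  case (node W Z C S)
  have sub: "W \<union> Z \<union> \<Union>(fst ` C) \<subseteq> fst G"
    using node.hyps(1,2) node.IH by (intro bag_subset) blast+
  show ?case
  proof (cases "W = {}")
    case True
    then obtain Z' S' where "(Z', S') \<in> C" "S' \<noteq> {}"
      using node.prems(2) node.hyps(3) by fastforce
    then show ?thesis using node.IH node.prems(1) by blast
  next
    case False
    then have "card (W \<union> Z \<union> \<Union>(fst ` C)) > 0"
      using finite_subset[OF sub node.prems(1)] by (simp only: card_gt_0_iff) blast
    then show ?thesis using node.hyps(4) by linarith
  qed
qed

text \<open>A walk of \<open>H\<close> that violates normality there is a walk of \<open>G\<close>
  that violates it for \<open>Z\<close> and \<open>S\<close>.\<close>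

lemma normal_subgraph:
  assumes "normal G Z S" "fst H \<subseteq> fst G" "snd H \<subseteq> snd G"
  shows "normal H (Z \<inter> fst H) (S \<inter> fst H)"
  unfolding normal_def
proof (rule notI, elim exE conjE bexE)
  fix w x
  assume w: "is_walk (snd H) w" "set w \<subseteq> fst H - Z \<inter> fst H"
    "hd w \<in> S \<inter> fst H" "last w \<in> S \<inter> fst H" "x \<in> set w" "x \<notin> Z \<inter> fst H \<union> S \<inter> fst H"
  have "is_walk (snd G) w" using w(1) assms(3) unfolding is_walk_def by blast
  moreover have "set w \<subseteq> fst G - Z" "x \<notin> Z \<union> S" using w assms(2) by blast+
  ultimately show False using assms(1) w unfolding normal_def by blast
qed

text \<open>Every block, label and branch is intersected with \<open>fst H\<close>: normality
  survives and bags only shrink.\<close>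

lemma tree_dec_subgraph:
  assumes "tree_dec G k Z S" "finite (fst G)" "fst H \<subseteq> fst G" "snd H \<subseteq> snd G"
  shows "tree_dec H k (Z \<inter> fst H) (S \<inter> fst H)"
  using assms(1)
proof (induction rule: tree_dec.induct)
  case (node W Z C S)
  let ?r = "\<lambda>(Z', S'). (Z' \<inter> fst H, S' \<inter> fst H)"
  have sub: "W \<union> Z \<union> \<Union>(fst ` C) \<subseteq> fst G"
    using node.hyps(1,2) node.IH by (intro bag_subset) blast+
  have "card (W \<inter> fst H \<union> Z \<inter> fst H \<union> \<Union>(fst ` ?r ` C)) \<le> card (W \<union> Z \<union> \<Union>(fst ` C))"
    by (rule card_mono[OF finite_subset[OF sub assms(2)]]) force
  then have "card (W \<inter> fst H \<union> Z \<inter> fst H \<union> \<Union>(fst ` ?r ` C)) \<le> k"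
    using node.hyps(4) by linarith
  moreover have "S \<inter> fst H = W \<inter> fst H \<union> \<Union>(snd ` ?r ` C)"
    using node.hyps(3) by force
  ultimately show ?case
    using node.IH normal_subgraph[OF _ assms(3,4)]
    by (intro tree_dec.node[where W = "W \<inter> fst H" and C = "?r ` C"]) auto
qed

section \<open>Tree-decompositions of series compositions\<close>

text \<open>The walk \<open>s, t, s\<close> forces \<open>s\<close> and \<open>t\<close> into the same part whenever
  \<open>s\<close> lies in \<open>S - Z\<close> and \<open>t\<close> outside \<open>S \<union> Z\<close>.\<close>
lemma normal_series_cases:
  assumes "normal G Z S" "S \<subseteq> fst G"
    and V: "fst G = (\<Union>i\<in>I. fst (F i))"
    and cross: "\<And>i j u v. \<lbrakk>i \<in> I; j \<in> I; i \<noteq> j; u \<in> fst (F i); v \<in> fst (F j)\<rbrakk> \<Longrightarrow> (u, v) \<in> snd G"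
  obtains "S \<subseteq> Z" | "S \<union> Z \<supseteq> fst G" | i where "i \<in> I" "fst G - fst (F i) \<subseteq> Z"
proof -
  have same: "i = j" if "s \<in> S - Z" "t \<in> fst G - (S \<union> Z)" "i \<in> I" "j \<in> I" "s \<in> fst (F i)" "t \<in> fst (F j)"
    for s t i j
  proof (rule ccontr)
    assume "i \<noteq> j"
    then have "(s, t) \<in> snd G" "(t, s) \<in> snd G" using cross that by auto
    then have "is_walk (snd G) [s, t, s]"
      by (auto simp: is_walk_def less_Suc_eq nth_Cons split: nat.splits)
    moreover have "set [s, t, s] \<subseteq> fst G - Z" "t \<in> set [s, t, s]" "t \<notin> Z \<union> S"
      "hd [s, t, s] \<in> S" "last [s, t, s] \<in> S"
      using that assms(2) by auto
    ultimately show False using assms(1) unfolding normal_def by blast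
  qed
  show ?thesis
  proof (cases "S \<subseteq> Z \<or> S \<union> Z \<supseteq> fst G")
    case True
    then show ?thesis using that by blast
  next
    case False
    then obtain s t where st: "s \<in> S - Z" "t \<in> fst G - (S \<union> Z)" by blast
    then obtain i where i: "i \<in> I" "s \<in> fst (F i)" using V assms(2) by blast
    obtain j where "j \<in> I" "t \<in> fst (F j)" using V st by blast
    then have ti: "t \<in> fst (F i)" using same st i by blast
    have "fst G - fst (F i) \<subseteq> Z"
    proof
      fix x assume x: "x \<in> fst G - fst (F i)"
      then obtain l where l: "l \<in> I" "x \<in> fst (F l)" using V by blast
      \<comment> \<open>Outside \<open>Z\<close>, the vertex \<open>x\<close> would fall into the
        part \<open>F i\<close>: by comparison with \<open>s\<close> if \<open>x\<close> is not in
        \<open>S\<close>, and with \<open>t\<close> if it is.\<close>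
      show "x \<in> Z"
        using same[OF st(1) _ i(1) l(1) i(2) l(2)] same[OF _ st(2) l(1) i(1) l(2) ti] x l by blast
    qed
    then show ?thesis using that i by blast
  qed
qed

text \<open>Unless one bag contains all of \<open>fst G\<close>, the bags outside trivial branches all contain
  \<open>fst G - fst (F i)\<close> for a common \<open>i\<close>, and deleting this set leaves a decomposition of \<open>F i\<close>.
  The first conclusion treats subtrees that can serve as the whole tree.\<close>
lemma tree_dec_series_aux:
  fixes F :: "'i \<Rightarrow> 'a digraph"
  assumes "tree_dec G k Z S" and fin: "finite (fst G)"
    and V: "fst G = (\<Union>i\<in>I. fst (F i))"
    and disj: "\<And>i j. \<lbrakk>i \<in> I; j \<in> I; i \<noteq> j\<rbrakk> \<Longrightarrow> fst (F i) \<inter> fst (F j) = {}"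
    and E: "\<And>i. i \<in> I \<Longrightarrow> snd (F i) \<subseteq> snd G"
    and cross: "\<And>i j u v. \<lbrakk>i \<in> I; j \<in> I; i \<noteq> j; u \<in> fst (F i); v \<in> fst (F j)\<rbrakk> \<Longrightarrow> (u, v) \<in> snd G"
    and big: "k < card (fst G)"
    and none: "\<And>i. i \<in> I \<Longrightarrow> \<not> tree_dec (F i) (k - card (fst G - fst (F i))) {} (fst (F i))"
  shows "\<not> fst G \<subseteq> S \<union> Z \<and> (\<forall>i\<in>I. fst G - fst (F i) \<subseteq> Z \<longrightarrow>
    tree_dec (F i) (k - card (fst G - fst (F i))) (Z \<inter> fst (F i)) (S \<inter> fst (F i)))"
  using assms(1)
proof (induction rule: tree_dec.induct)
  case (node W Z C S)
  define B where "B = W \<union> Z \<union> \<Union>(fst ` C)"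
  \<comment> \<open>These child arcs are contracted: their branches lie inside their own labels, so
    \<open>WA\<close> absorbs them into the block without enlarging the bag
    \<open>B\<close>.\<close>
  define CA where "CA = {c \<in> C. snd c \<subseteq> fst c}"
  define WA where "WA = W \<union> \<Union>(snd ` CA)"
  have BG: "B \<subseteq> fst G"
    unfolding B_def using node.hyps(1,2) node.IH by (intro bag_subset) blast+
  have finB: "finite B" using BG fin finite_subset by blast
  have WAB: "WA \<subseteq> B" unfolding WA_def B_def CA_def by fastforce
  have SW: "S = WA \<union> \<Union>(snd ` (C - CA))"
    using node.hyps(3) unfolding WA_def CA_def by blast
  have BV: "\<not> fst G \<subseteq> B"
    using node.hyps(4) big card_mono[OF finB, of "fst G"] unfolding B_def by linarith
  \<comment> \<open>Of the three cases for a normal set, the first is excluded by the choice of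
    \<open>CA\<close> and the second by the induction hypothesis.\<close>
  have ex: "\<exists>i\<in>I. fst G - fst (F i) \<subseteq> Z'" if c: "(Z', S') \<in> C - CA" for Z' S'
  proof -
    have "normal G Z' S'" "S' \<subseteq> fst G" using node.IH c tree_dec_subset by blast+
    then show ?thesis
    proof (rule normal_series_cases[OF _ _ V cross])
      assume "S' \<subseteq> Z'"
      then show ?thesis using c unfolding CA_def by simp
    next
      assume "fst G \<subseteq> S' \<union> Z'"
      then show ?thesis using node.IH c by blast
    qed auto
  qed
  \<comment> \<open>Deleting \<open>fst G - fst (F i)\<close> from the bag lowers its size by
    exactly the size of that set. \<open>Zi\<close> and \<open>Wi\<close> stay free because the node
    is used both as a new root with empty label and as an inner node below the restricted
    label.\<close>
  have key: "tree_dec (F i) (k - card (fst G - fst (F i))) Zi Si"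
    if i: "i \<in> I" and U: "fst G - fst (F i) \<subseteq> B" and Zi: "Zi \<subseteq> B \<inter> fst (F i)"
      and Wi: "Wi \<subseteq> B \<inter> fst (F i)" and Si: "Si = Wi \<union> (\<Union>(snd ` (C - CA)) \<inter> fst (F i))" for i Zi Wi Si
  proof -
    let ?r = "\<lambda>(Z', S'). (Z' \<inter> fst (F i), S' \<inter> fst (F i))"
    let ?U = "fst G - fst (F i)"
    have FiG: "fst (F i) \<subseteq> fst G" using V i by blast
    have child: "normal (F i) (Z' \<inter> fst (F i)) (S' \<inter> fst (F i)) \<and>
        tree_dec (F i) (k - card ?U) (Z' \<inter> fst (F i)) (S' \<inter> fst (F i))" if c: "(Z', S') \<in> C - CA" for Z' S'
    proof -
      obtain j where j: "j \<in> I" "fst G - fst (F j) \<subseteq> Z'" using ex[OF c] by blast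
      have "Z' \<subseteq> B" using c unfolding B_def by force
      \<comment> \<open>For distinct \<open>i\<close> and \<open>j\<close> the complements of the
        two parts would cover \<open>fst G\<close>, and both lie in \<open>B\<close>, contradicting
        \<open>BV\<close>.\<close>
      then have "j = i" using disj[OF j(1) i] j U BV by blast
      then show ?thesis using node.IH c j i normal_subgraph[OF _ FiG E[OF i]] by blast
    qed
    have "card (Wi \<union> Zi \<union> \<Union>(fst ` ?r ` (C - CA))) \<le> card (B - ?U)"
    proof (rule card_mono)
      show "finite (B - ?U)" using finB by blast
      show "Wi \<union> Zi \<union> \<Union>(fst ` ?r ` (C - CA)) \<subseteq> B - ?U"
        using Wi Zi unfolding B_def by force
    qed
    also have "\<dots> = card B - card ?U" using U fin by (simp add: card_Diff_subset)
    also have "\<dots> \<le> k - card ?U" using node.hyps(4) unfolding B_def by simp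
    finally have "card (Wi \<union> Zi \<union> \<Union>(fst ` ?r ` (C - CA))) \<le> k - card ?U" .
    moreover have "Si = Wi \<union> \<Union>(snd ` ?r ` (C - CA))" unfolding Si by force
    ultimately show ?thesis using Zi Wi child
      by (intro tree_dec.node[where W = Wi and C = "?r ` (C - CA)"]) auto
  qed
  have "\<not> fst G \<subseteq> S \<union> Z"
  proof
    assume a: "fst G \<subseteq> S \<union> Z"
    \<comment> \<open>With all child arcs contracted, \<open>S \<union> Z\<close> would lie in
      \<open>B\<close>, so the bag would be all of \<open>fst G\<close>.\<close>
    have "C - CA \<noteq> {}"
      using a SW WAB BV unfolding B_def by auto
    then obtain Z' S' where c: "(Z', S') \<in> C - CA" by fast
    then obtain i where i: "i \<in> I" "fst G - fst (F i) \<subseteq> Z'" using ex by blast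
    have "Z' \<subseteq> B" using c unfolding B_def by force
    moreover have "fst (F i) \<subseteq> fst G" using V i by blast
    \<comment> \<open>Since \<open>S \<union> Z\<close> is everything, moving \<open>Z\<close> into
      the block makes this node the root of a decomposition of all of \<open>F i\<close>.\<close>
    ultimately have "tree_dec (F i) (k - card (fst G - fst (F i))) {} (fst (F i))"
      using i a SW WAB by (intro key[where Wi = "(WA \<union> Z) \<inter> fst (F i)"]) (auto simp: B_def)
    then show False using none i by blast
  qed
  moreover have "tree_dec (F i) (k - card (fst G - fst (F i))) (Z \<inter> fst (F i)) (S \<inter> fst (F i))"
    if "i \<in> I" "fst G - fst (F i) \<subseteq> Z" for i
    using that SW WAB by (intro key[where Wi = "WA \<inter> fst (F i)"]) (auto simp: B_def)
  ultimately show ?case by blast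
qed

text \<open>If both alternatives fail, \<open>tree_dec_series_aux\<close> applies at the root, where
  its first conclusion is absurd because \<open>S\<close> is all of \<open>fst G\<close>.\<close>

lemma tree_dec_series:
  fixes F :: "'i \<Rightarrow> 'a digraph"
  assumes "tree_dec G k {} (fst G)" "finite (fst G)"
    and "fst G = (\<Union>i\<in>I. fst (F i))"
    and "\<And>i j. \<lbrakk>i \<in> I; j \<in> I; i \<noteq> j\<rbrakk> \<Longrightarrow> fst (F i) \<inter> fst (F j) = {}"
    and "\<And>i. i \<in> I \<Longrightarrow> snd (F i) \<subseteq> snd G"
    and "\<And>i j u v. \<lbrakk>i \<in> I; j \<in> I; i \<noteq> j; u \<in> fst (F i); v \<in> fst (F j)\<rbrakk> \<Longrightarrow> (u, v) \<in> snd G"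
  obtains "card (fst G) \<le> k"
    | i where "i \<in> I" "tree_dec (F i) (k - card (fst G - fst (F i))) {} (fst (F i))"
proof (rule ccontr)
  assume n: "\<not> thesis"
  note part = that(2)
  have "k < card (fst G)" using n that(1) by (meson not_le)
  moreover have "\<not> tree_dec (F i) (k - card (fst G - fst (F i))) {} (fst (F i))" if "i \<in> I" for i
    using n part that by blast
  ultimately show False using tree_dec_series_aux[OF assms] by simp
qed

section \<open>Constructions of path-decompositions\<close>

lemma UN_nth: "(\<Union>i<length Xs. Xs ! i) = \<Union>(set Xs)"
proof -
  have "set Xs = (!) Xs ` {..<length Xs}" by (auto simp: set_conv_nth)
  then show ?thesis by simp
qed

lemma is_dpd_bags: "is_dpd G Xs \<Longrightarrow> \<Union>(set Xs) = fst G"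
  unfolding is_dpd_def UN_nth by blast

lemma is_dpd_arc:
  assumes "is_dpd G Xs" "(u, v) \<in> snd G"
  obtains i j where "i < length Xs" "j < length Xs" "i \<le> j" "u \<in> Xs ! i" "v \<in> Xs ! j"
proof -
  have "\<forall>(u, v)\<in>snd G. \<exists>i<length Xs. \<exists>j<length Xs. i \<le> j \<and> u \<in> Xs ! i \<and> v \<in> Xs ! j"
    using assms(1) unfolding is_dpd_def by (elim conjE)
  from bspec[OF this assms(2)] show ?thesis using that by auto
qed

lemma is_dpd_consec:
  "\<lbrakk>is_dpd G Xs; i \<le> j; j \<le> k; k < length Xs; v \<in> Xs ! i; v \<in> Xs ! k\<rbrakk> \<Longrightarrow> v \<in> Xs ! j"
  unfolding is_dpd_def by blast

lemma is_dpdI: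
  assumes un: "\<Union>(set Xs) = fst G"
    and arc: "\<And>u v. (u, v) \<in> snd G \<Longrightarrow> \<exists>i<length Xs. \<exists>j<length Xs. i \<le> j \<and> u \<in> Xs ! i \<and> v \<in> Xs ! j"
    and consec: "\<And>v i j k. \<lbrakk>i \<le> j; j \<le> k; k < length Xs; v \<in> Xs ! i; v \<in> Xs ! k\<rbrakk> \<Longrightarrow> v \<in> Xs ! j"
  shows "is_dpd G Xs"
proof -
  have "Xs ! i \<subseteq> fst G" if "i < length Xs" for i using nth_mem[OF that] un by blast
  moreover have "\<forall>(u, v)\<in>snd G. \<exists>i<length Xs. \<exists>j<length Xs. i \<le> j \<and> u \<in> Xs ! i \<and> v \<in> Xs ! j"
    using arc by blast
  ultimately show ?thesis unfolding is_dpd_def UN_nth using un consec by blast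
qed

lemma is_dpd_single: "snd G \<subseteq> fst G \<times> fst G \<Longrightarrow> is_dpd G [fst G]"
  by (rule is_dpdI) auto

lemma is_dpd_mono_arcs:
  assumes "is_dpd (V, E) Xs" "E' \<subseteq> E"
  shows "is_dpd (V, E') Xs"
proof (rule is_dpdI)
  show "\<Union>(set Xs) = fst (V, E')" using is_dpd_bags[OF assms(1)] by simp
  show "\<exists>i<length Xs. \<exists>j<length Xs. i \<le> j \<and> u \<in> Xs ! i \<and> v \<in> Xs ! j" if "(u, v) \<in> snd (V, E')" for u v
  proof -
    have "(u, v) \<in> snd (V, E)" using that assms(2) by auto
    then show ?thesis by (rule is_dpd_arc[OF assms(1)]) blast
  qed
qed (rule is_dpd_consec[OF assms(1)])

text \<open>All bags of \<open>Xs\<close> precede those of \<open>Ys\<close>, which admits every arc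
  from \<open>V1\<close> to \<open>V2\<close>; disjointness keeps the bags of each vertex
  consecutive.\<close>

lemma is_dpd_append:
  assumes X: "is_dpd (V1, E1) Xs" and Y: "is_dpd (V2, E2) Ys" and disj: "V1 \<inter> V2 = {}"
  shows "is_dpd (V1 \<union> V2, E1 \<union> E2 \<union> V1 \<times> V2) (Xs @ Ys)"
proof -
  let ?n = "length Xs" and ?m = "length Ys" and ?L = "Xs @ Ys"
  have LX: "?L ! i = Xs ! i" if "i < ?n" for i using that by (simp add: nth_append)
  have LY: "?L ! (?n + i) = Ys ! i" for i by simp
  have XV: "\<Union>(set Xs) = V1" and YV: "\<Union>(set Ys) = V2"
    using is_dpd_bags[OF X] is_dpd_bags[OF Y] by simp_all
  have nV2: "v \<notin> V2" if "v \<in> ?L ! i" "i < ?n" for v i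
  proof -
    have "v \<in> V1" using that LX XV nth_mem[OF that(2)] by blast
    then show ?thesis using disj by blast
  qed
  have nV1: "v \<notin> V1" if "v \<in> ?L ! i" "\<not> i < ?n" "i < ?n + ?m" for v i
  proof -
    have "i - ?n < ?m" using that by linarith
    then have "?L ! i \<subseteq> V2" using YV nth_mem[of "i - ?n" Ys] that(2) by (auto simp: nth_append)
    then show ?thesis using that disj by blast
  qed
  have arcs: "\<exists>i<length ?L. \<exists>j<length ?L. i \<le> j \<and> u \<in> ?L ! i \<and> v \<in> ?L ! j"
    if uv: "(u, v) \<in> E1 \<union> E2 \<union> V1 \<times> V2" for u v
  proof -
    consider "(u, v) \<in> E1" | "(u, v) \<in> E2" | "u \<in> V1" "v \<in> V2" using uv by blast
    then show ?thesis
    proof cases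
      case 1
      then obtain i j where "i < ?n" "j < ?n" "i \<le> j" "u \<in> Xs ! i" "v \<in> Xs ! j"
        by (auto elim: is_dpd_arc[OF X, unfolded snd_conv])
      then show ?thesis using LX by (intro exI[of _ i] conjI exI[of _ j]) auto
    next
      case 2
      then obtain i j where "i < ?m" "j < ?m" "i \<le> j" "u \<in> Ys ! i" "v \<in> Ys ! j"
        by (auto elim: is_dpd_arc[OF Y, unfolded snd_conv])
      then show ?thesis using LY by (intro exI[of _ "?n + i"] conjI exI[of _ "?n + j"]) auto
    next
      case 3
      obtain i where "i < ?n" "u \<in> Xs ! i" using 3(1) XV by (metis UnionE in_set_conv_nth)
      moreover obtain j where "j < ?m" "v \<in> Ys ! j" using 3(2) YV by (metis UnionE in_set_conv_nth)
      ultimately show ?thesis using LX LY by (intro exI[of _ i] conjI exI[of _ "?n + j"]) auto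
    qed
  qed
  have consec: "v \<in> ?L ! j"
    if h: "i \<le> j" "j \<le> k" "k < length ?L" "v \<in> ?L ! i" "v \<in> ?L ! k" for v i j k
  proof (cases "k < ?n")
    case True
    then have "v \<in> Xs ! j" using h LX by (intro is_dpd_consec[OF X, of i j k]) auto
    then show ?thesis using True h LX by simp
  next
    case False
    then have "v \<notin> V1" using nV1 h by simp
    \<comment> \<open>A bag \<open>i\<close> in \<open>Xs\<close> would put \<open>v\<close> into
      \<open>V1\<close>; so both bags lie in \<open>Ys\<close>, and only the shift by
      \<open>?n\<close> remains.\<close>
    then have "\<not> i < ?n" using h(4) LX[of i] XV nth_mem[of i Xs] by auto
    then have "v \<in> Ys ! (i - ?n)" "v \<in> Ys ! (k - ?n)" "k - ?n < ?m" "i - ?n \<le> j - ?n" "j - ?n \<le> k - ?n"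
      using False h by (auto simp: nth_append)
    then have "v \<in> Ys ! (j - ?n)" by (intro is_dpd_consec[OF Y, of "i - ?n" "j - ?n" "k - ?n"])
    then show ?thesis using \<open>\<not> i < ?n\<close> h(1) by (simp add: nth_append)
  qed
  show ?thesis
    using XV YV arcs consec by (intro is_dpdI) simp_all
qed

text \<open>The vertices outside \<open>H\<close> are added to every bag. An arc touching one of
  them then has both ends in a common bag, and every other arc belongs to \<open>H\<close>.\<close>

lemma dpd_bounded_series:
  assumes H: "dpd_bounded H k" and V: "fst H \<subseteq> fst G" "finite (fst G)"
    and E: "snd G \<subseteq> fst G \<times> fst G" "snd G \<inter> fst H \<times> fst H \<subseteq> snd H"
  shows "dpd_bounded G (k + card (fst G - fst H))"
proof -
  let ?U = "fst G - fst H"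
  obtain Xs where Xs: "Xs \<noteq> []" "is_dpd H Xs" "\<forall>X\<in>set Xs. card X \<le> k"
    using H unfolding dpd_bounded_def by blast
  let ?L = "map (\<lambda>X. X \<union> ?U) Xs"
  have XV: "\<Union>(set Xs) = fst H" using is_dpd_bags[OF Xs(2)] .
  have un: "\<Union>(set ?L) = fst G" using XV V(1) Xs(1) by (auto simp: neq_Nil_conv)
  have mem: "\<exists>i<length Xs. u \<in> Xs ! i \<union> ?U" if "u \<in> fst G" for u
    using that un by (metis (no_types, lifting) UnionE in_set_conv_nth length_map nth_map)
  have arcs: "\<exists>i<length ?L. \<exists>j<length ?L. i \<le> j \<and> u \<in> ?L ! i \<and> v \<in> ?L ! j" if uv: "(u, v) \<in> snd G" for u v
  proof -
    have G: "u \<in> fst G" "v \<in> fst G" using uv E(1) by auto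
    show ?thesis
    proof (cases "u \<in> ?U \<or> v \<in> ?U")
      case True
      then have "\<exists>i<length Xs. u \<in> Xs ! i \<union> ?U \<and> v \<in> Xs ! i \<union> ?U" using mem G by blast
      then obtain i where "i < length ?L" "u \<in> ?L ! i" "v \<in> ?L ! i" by auto
      then show ?thesis by blast
    next
      case False
      then have "(u, v) \<in> snd H" using uv G E(2) by blast
      then obtain i j where "i < length Xs" "j < length Xs" "i \<le> j" "u \<in> Xs ! i" "v \<in> Xs ! j"
        using is_dpd_arc[OF Xs(2)] by blast
      then show ?thesis by (intro exI[of _ i] conjI exI[of _ j]) auto
    qed
  qed
  have consec: "v \<in> ?L ! j"
    if h: "i \<le> j" "j \<le> l" "l < length ?L" "v \<in> ?L ! i" "v \<in> ?L ! l" for v i j l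
  proof (cases "v \<in> ?U")
    case False
    then have "v \<in> Xs ! i" "v \<in> Xs ! l" "l < length Xs" using h by auto
    then have "v \<in> Xs ! j" using h(1,2) is_dpd_consec[OF Xs(2)] by blast
    then show ?thesis using h by simp
  qed (use h in simp)
  have "is_dpd G ?L" using un arcs consec by (rule is_dpdI)
  moreover have "card (X \<union> ?U) \<le> k + card ?U" if "X \<in> set Xs" for X
    using that Xs(3) card_Un_le[of X ?U] by (meson add_le_mono1 order_trans)
  ultimately show ?thesis unfolding dpd_bounded_def using Xs(1) by (intro exI[of _ ?L]) auto
qed

section \<open>Directed unions of lists of digraphs\<close>

lemma disj_union_V_Cons: "disj_union_V (G # Gs) = fst G \<union> disj_union_V Gs"
  unfolding disj_union_V_def by (simp add: lessThan_Suc_eq_insert_0 image_image)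

lemma disj_union_V_conv: "disj_union_V Gs = \<Union>(fst ` set Gs)"
  by (induction Gs) (simp_all add: disj_union_V_Cons, simp add: disj_union_V_def)

lemma disj_union_E_Cons: "disj_union_E (G # Gs) = snd G \<union> disj_union_E Gs"
  unfolding disj_union_E_def by (simp add: lessThan_Suc_eq_insert_0 image_image)

lemma disj_union_E_conv: "disj_union_E Gs = \<Union>(snd ` set Gs)"
  by (induction Gs) (simp_all add: disj_union_E_Cons, simp add: disj_union_E_def)

lemma vdisjoint_ConsD:
  assumes "vdisjoint (G # Gs)"
  shows "vdisjoint Gs" "fst G \<inter> disj_union_V Gs = {}"
proof -
  have *: "fst ((G # Gs) ! i) \<inter> fst ((G # Gs) ! j) = {}"
    if "i \<le> length Gs" "j \<le> length Gs" "i \<noteq> j" for i j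
    using assms that unfolding vdisjoint_def by simp
  show "vdisjoint Gs" unfolding vdisjoint_def using *[of "Suc _" "Suc _"] by simp
  have "fst G \<inter> fst (Gs ! i) = {}" if "i < length Gs" for i using *[of 0 "Suc i"] that by simp
  then show "fst G \<inter> disj_union_V Gs = {}" unfolding disj_union_V_def by blast
qed

text \<open>Decompositions of the parts are concatenated in list order. \<open>E\<close> is only
  bounded above because a directed union may omit any forward arcs.\<close>

lemma dpd_bounded_directed_union:
  assumes "Gs \<noteq> []" "vdisjoint Gs" "\<forall>G\<in>set Gs. dpd_bounded G k"
    and "E \<subseteq> disj_union_E Gs \<union> {(u, v). \<exists>i<length Gs. \<exists>j<length Gs. i < j \<and> u \<in> fst (Gs ! i) \<and> v \<in> fst (Gs ! j)}"
  shows "dpd_bounded (disj_union_V Gs, E) k"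
  using assms
proof (induction Gs arbitrary: E)
  case (Cons G Gs)
  let ?D = "\<lambda>Gs. {(u, v). \<exists>i<length Gs. \<exists>j<length Gs. i < j \<and> u \<in> fst (Gs ! i) \<and> v \<in> fst (Gs ! j)}"
  obtain Xs where Xs: "Xs \<noteq> []" "is_dpd G Xs" "\<forall>X\<in>set Xs. card X \<le> k"
    using Cons.prems(3) unfolding dpd_bounded_def by auto
  have D: "?D (G # Gs) \<subseteq> ?D Gs \<union> fst G \<times> disj_union_V Gs"
  proof (rule subrelI)
    fix u v assume "(u, v) \<in> ?D (G # Gs)"
    then obtain i j where ij: "j < Suc (length Gs)" "i < j" "u \<in> fst ((G # Gs) ! i)" "v \<in> fst ((G # Gs) ! j)"
      by auto
    then obtain j' where j': "j = Suc j'" "j' < length Gs" "v \<in> fst (Gs ! j')"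
      by (cases j) auto
    show "(u, v) \<in> ?D Gs \<union> fst G \<times> disj_union_V Gs"
    proof (cases i)
      case 0
      then show ?thesis using ij j' unfolding disj_union_V_def by auto
    next
      case (Suc i')
      then have "i' < length Gs" "i' < j'" "u \<in> fst (Gs ! i')" using ij j' by auto
      then have "(u, v) \<in> ?D Gs" using j' by blast
      then show ?thesis by blast
    qed
  qed
  show ?case
  proof (cases "Gs = []")
    case True
    then have "E \<subseteq> snd G" using Cons.prems(4) by (simp add: disj_union_E_conv)
    then have "is_dpd (fst G, E) Xs" using Xs(2) is_dpd_mono_arcs[of "fst G" "snd G"] by simp
    then show ?thesis using Xs True unfolding dpd_bounded_def disj_union_V_conv by auto
  next
    case False
    \<comment> \<open>The induction hypothesis is taken for the tail with all its forward arcs; arcs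
      absent from \<open>E\<close> are dropped after concatenation.\<close>
    have "dpd_bounded (disj_union_V Gs, disj_union_E Gs \<union> ?D Gs) k"
      using False Cons.prems(3) vdisjoint_ConsD(1)[OF Cons.prems(2)] by (intro Cons.IH) auto
    then obtain Ys where Ys: "is_dpd (disj_union_V Gs, disj_union_E Gs \<union> ?D Gs) Ys" "\<forall>X\<in>set Ys. card X \<le> k"
      unfolding dpd_bounded_def by blast
    have "is_dpd (fst G \<union> disj_union_V Gs,
        snd G \<union> (disj_union_E Gs \<union> ?D Gs) \<union> fst G \<times> disj_union_V Gs) (Xs @ Ys)"
      using Xs(2) Ys(1) vdisjoint_ConsD(2)[OF Cons.prems(2)] by (intro is_dpd_append) auto
    moreover have "E \<subseteq> snd G \<union> (disj_union_E Gs \<union> ?D Gs) \<union> fst G \<times> disj_union_V Gs"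
      using Cons.prems(4) D unfolding disj_union_E_Cons by blast
    ultimately have "is_dpd (fst G \<union> disj_union_V Gs, E) (Xs @ Ys)" by (rule is_dpd_mono_arcs)
    then show ?thesis using Xs Ys(2) unfolding dpd_bounded_def disj_union_V_Cons
      by (intro exI[of _ "Xs @ Ys"]) auto
  qed
qed simp

section \<open>From tree-decompositions to path-decompositions on extended directed
  co-graphs\<close>

lemma ext_dicograph_wf:
  assumes "ext_dicograph G"
  shows "finite (fst G) \<and> fst G \<noteq> {} \<and> snd G \<subseteq> fst G \<times> fst G"
  using assms
proof (induction rule: ext_dicograph.induct)
  case (dunion Gs H)
  then have *: "fst H = disj_union_V Gs" "snd H \<subseteq> disj_union_E Gs \<union> fst H \<times> fst H"
    unfolding is_directed_union_def disj_union_V_def by fastforce+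
  have "disj_union_E Gs \<subseteq> fst H \<times> fst H"
    using dunion.IH unfolding *(1) disj_union_E_conv disj_union_V_conv by blast
  moreover have "finite (fst H)" using dunion.IH unfolding *(1) disj_union_V_conv by blast
  moreover have "fst H \<noteq> {}"
    using dunion.IH hd_in_set[OF dunion.hyps(1)] unfolding *(1) disj_union_V_conv by blast
  ultimately show ?case using *(2) by blast
next
  case (series Gs)
  have *: "fst (series_comp Gs) = disj_union_V Gs" unfolding series_comp_def by simp
  have "snd (series_comp Gs) \<subseteq> disj_union_E Gs \<union> disj_union_V Gs \<times> disj_union_V Gs"
    unfolding series_comp_def disj_union_V_def by auto
  moreover have "disj_union_E Gs \<subseteq> disj_union_V Gs \<times> disj_union_V Gs"
    using series.IH unfolding disj_union_E_conv disj_union_V_conv by blast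
  moreover have "finite (disj_union_V Gs)" using series.IH unfolding disj_union_V_conv by blast
  moreover have "disj_union_V Gs \<noteq> {}"
    using series.IH hd_in_set[OF series.hyps(1)] unfolding disj_union_V_conv by blast
  ultimately show ?case unfolding * by blast
qed simp

text \<open>Induction on the construction of \<open>G\<close>. The bound varies: a directed union
  passes \<open>k\<close> on to its parts, whereas a series composition passes a smaller bound to a
  single part.\<close>

lemma tree_dec_imp_dpd_bounded:
  assumes "ext_dicograph G" "tree_dec G k {} (fst G)"
  shows "dpd_bounded G k"
  using assms
proof (induction arbitrary: k rule: ext_dicograph.induct)
  case (single v)
  have "is_dpd ({v}, {}) [{v}]" using is_dpd_single[of "({v}, {})"] by simp
  moreover have "0 < k" using single tree_dec_pos by fastforce
  ultimately show ?case unfolding dpd_bounded_def by (intro exI[of _ "[{v}]"]) auto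
next
  case (dunion Gs H)
  have H: "ext_dicograph H" 
    using dunion.IH by (intro ext_dicograph.dunion[OF dunion.hyps(1,2) _ dunion.hyps(3)]) blast
  obtain A where A: "A \<subseteq> {(u, v). \<exists>i<length Gs. \<exists>j<length Gs. i < j \<and> u \<in> fst (Gs ! i) \<and> v \<in> fst (Gs ! j)}"
    "H = (disj_union_V Gs, disj_union_E Gs \<union> A)"
    using dunion.hyps(3) unfolding is_directed_union_def by blast
  have "dpd_bounded G k" if G: "G \<in> set Gs" for G
  proof -
    have sub: "fst G \<subseteq> fst H" "snd G \<subseteq> snd H"
      using G A(2) unfolding disj_union_V_conv disj_union_E_conv by auto
    then have "tree_dec G k ({} \<inter> fst G) (fst H \<inter> fst G)"
      using dunion.prems ext_dicograph_wf[OF H] by (intro tree_dec_subgraph) auto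
    then show ?thesis using G dunion.IH sub(1) by (auto simp: Int_absorb1)
  qed
  then show ?case unfolding A(2) using dunion.hyps A(1) by (intro dpd_bounded_directed_union) auto
next
  case (series Gs)
  let ?G = "series_comp Gs"
  have wf: "finite (fst ?G)" "snd ?G \<subseteq> fst ?G \<times> fst ?G"
    using ext_dicograph_wf[OF ext_dicograph.series[OF series.hyps]] series.IH by blast+
  have V: "fst ?G = (\<Union>i<length Gs. fst (Gs ! i))"
    unfolding series_comp_def disj_union_V_def by simp
  have disj: "fst (Gs ! i) \<inter> fst (Gs ! j) = {}" if "i < length Gs" "j < length Gs" "i \<noteq> j" for i j
    using series.hyps(2) that unfolding vdisjoint_def by blast
  show ?case
  proof (rule tree_dec_series[OF series.prems wf(1) V])
    show "fst (Gs ! i) \<inter> fst (Gs ! j) = {}" if "i \<in> {..<length Gs}" "j \<in> {..<length Gs}" "i \<noteq> j" for i j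
      using disj that by simp
    show "snd (Gs ! i) \<subseteq> snd ?G" if "i \<in> {..<length Gs}" for i
      using that unfolding series_comp_def disj_union_E_def by auto
    show "(u, v) \<in> snd ?G"
      if "i \<in> {..<length Gs}" "j \<in> {..<length Gs}" "i \<noteq> j" "u \<in> fst (Gs ! i)" "v \<in> fst (Gs ! j)" for i j u v
      using that unfolding series_comp_def by auto
  next
    assume "card (fst ?G) \<le> k"
    then show ?thesis using is_dpd_single[OF wf(2)] unfolding dpd_bounded_def by fastforce
  next
    fix i assume i: "i \<in> {..<length Gs}"
      and dec: "tree_dec (Gs ! i) (k - card (fst ?G - fst (Gs ! i))) {} (fst (Gs ! i))"
    let ?U = "fst ?G - fst (Gs ! i)"
    have Gi: "Gs ! i \<in> set Gs" using i by simp
    then have wfi: "finite (fst (Gs ! i))" "fst (Gs ! i) \<noteq> {}"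
      using series.IH ext_dicograph_wf by blast+
    have "dpd_bounded (Gs ! i) (k - card ?U)" using series.IH Gi dec by blast
    \<comment> \<open>The part is an induced subgraph: by disjointness, no arc between different
      parts has both ends in it.\<close>
    moreover have "snd ?G \<inter> fst (Gs ! i) \<times> fst (Gs ! i) \<subseteq> snd (Gs ! i)"
    proof (rule subrelI)
      fix u v assume uv: "(u, v) \<in> snd ?G \<inter> fst (Gs ! i) \<times> fst (Gs ! i)"
      have eq: "j = i" if "j < length Gs" "w \<in> fst (Gs ! j)" "w \<in> fst (Gs ! i)" for j w
        using disj[of i j] i that by blast
      from uv consider j where "j < length Gs" "(u, v) \<in> snd (Gs ! j)"
        | j l where "j < length Gs" "l < length Gs" "j \<noteq> l" "u \<in> fst (Gs ! j)" "v \<in> fst (Gs ! l)"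
        unfolding series_comp_def disj_union_E_def by auto
      then show "(u, v) \<in> snd (Gs ! i)"
      proof cases
        case 1
        then have "u \<in> fst (Gs ! j)" using series.IH ext_dicograph_wf nth_mem by blast
        then show ?thesis using 1 eq uv by blast
      next
        case 2
        then show ?thesis using eq uv by blast
      qed
    qed
    moreover have "fst (Gs ! i) \<subseteq> fst ?G" using V i by blast
    ultimately have "dpd_bounded ?G (k - card ?U + card ?U)"
      using wf by (intro dpd_bounded_series) auto
    \<comment> \<open>Positivity rules out truncation, so subtracting and adding back
      \<open>card ?U\<close> returns \<open>k\<close>.\<close>
    moreover have "0 < k - card ?U" using tree_dec_pos[OF dec wfi] .
    ultimately show ?thesis by simp
  qed
qed

section \<open>From out-trees to the inductive form of tree-decompositions\<close>

text \<open>A cycle through a node uses its only incoming arc, hence passes through its parent;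
  tracing this back reaches the root, which has no incoming arc. Acyclicity provides the induction
  from the leaves.\<close>

lemma out_tree_acyclic:
  assumes "out_tree VT ET"
  shows "acyclic ET"
proof -
  obtain root where root: "root \<in> VT" "\<forall>u. (u, root) \<notin> ET"
    "\<forall>v\<in>VT. v \<noteq> root \<longrightarrow> (\<exists>!u. (u, v) \<in> ET)" "\<forall>v\<in>VT. (root, v) \<in> ET\<^sup>*"
    and sub: "ET \<subseteq> VT \<times> VT"
    using assms unfolding out_tree_def by blast
  have "(v, v) \<notin> ET\<^sup>+" if "(root, v) \<in> ET\<^sup>*" for v
    using that
  proof (induction rule: rtrancl_induct)
    case base
    then show ?case using root(2) by (meson tranclD2)
  next
    case (step y z)
    show ?case
    proof
      assume "(z, z) \<in> ET\<^sup>+"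
      then obtain p where p: "(z, p) \<in> ET\<^sup>*" "(p, z) \<in> ET" by (meson tranclD2)
      have z: "z \<in> VT" "z \<noteq> root" using step.hyps(2) sub root(2) by auto
      have "\<exists>!u. (u, z) \<in> ET" using root(3) z by blast
      then have "p = y" using p(2) step.hyps(2) by blast
      then have "(y, y) \<in> ET\<^sup>+" using p by (meson rtrancl_into_trancl2)
      then show False using step.IH by blast
    qed
  qed
  moreover have "v \<in> VT" if "(v, v) \<in> ET\<^sup>+" for v using that sub by (meson SigmaD1 subsetD tranclD)
  ultimately show ?thesis using root(4) unfolding acyclic_def by blast
qed

lemma dtd_imp_tree_dec:
  assumes dtd: "is_dtd G VT ET X W" and fin: "finite (fst G)"
    and k: "\<And>r. r \<in> VT \<Longrightarrow> card (W r \<union> \<Union>{X e | e. e \<in> ET \<and> (fst e = r \<or> snd e = r)}) \<le> k"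
  shows "tree_dec G k {} (fst G)"
proof -
  define S where "S v = \<Union>{W r | r. r \<in> VT \<and> (v, r) \<in> ET\<^sup>*}" for v
  have tree: "out_tree VT ET"
    and X: "\<And>e. e \<in> ET \<Longrightarrow> X e \<subseteq> fst G"
    and W: "\<And>r. r \<in> VT \<Longrightarrow> W r \<subseteq> fst G" "(\<Union>r\<in>VT. W r) = fst G"
    and normal: "\<And>u v. (u, v) \<in> ET \<Longrightarrow> normal G (X (u, v)) (S v)"
    using dtd unfolding is_dtd_def S_def by auto
  have sub: "ET \<subseteq> VT \<times> VT" and finV: "finite VT" using tree unfolding out_tree_def by blast+
  have "wf (ET\<inverse>)"
    using out_tree_acyclic[OF tree] finite_subset[OF sub] finV by (intro finite_acyclic_wf_converse) auto
  \<comment> \<open>The empty label serves the root; otherwise \<open>Z\<close> labels an arc into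
    \<open>v\<close>. In both cases the labels around \<open>v\<close> stay within its original
    bag.\<close>
  then have main: "tree_dec G k Z (S v)" if "v \<in> VT" "Z = {} \<or> (\<exists>p. (p, v) \<in> ET \<and> Z = X (p, v))" for v Z
    using that
  proof (induction v arbitrary: Z rule: wf_induct_rule)
    case (less v)
    let ?C = "{(X (v, c), S c) | c. (v, c) \<in> ET}"
    have "S v = W v \<union> \<Union>(snd ` ?C)"
    proof -
      have "(v, r) \<in> ET\<^sup>* \<longleftrightarrow> r = v \<or> (\<exists>c. (v, c) \<in> ET \<and> (c, r) \<in> ET\<^sup>*)" for r
        by (auto elim: converse_rtranclE intro: converse_rtrancl_into_rtrancl)
      then have "x \<in> S v \<longleftrightarrow> x \<in> W v \<or> (\<exists>c. (v, c) \<in> ET \<and> x \<in> S c)" for x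
        unfolding S_def using less.prems(1) by (simp add: ex_disj_distrib) metis
      moreover have "\<Union>(snd ` ?C) = (\<Union>c\<in>{c. (v, c) \<in> ET}. S c)" by force
      ultimately show ?thesis by blast
    qed
    moreover have "card (W v \<union> Z \<union> \<Union>(fst ` ?C)) \<le> k"
    proof -
      let ?B = "W v \<union> \<Union>{X e | e. e \<in> ET \<and> (fst e = v \<or> snd e = v)}"
      have "?B \<subseteq> fst G" using X W(1) less.prems(1) by blast
      then have "finite ?B" using fin finite_subset by blast
      moreover have "W v \<union> Z \<union> \<Union>(fst ` ?C) \<subseteq> ?B"
        using less.prems(2) by fastforce
      ultimately show ?thesis by (rule order_trans[OF card_mono k[OF less.prems(1)]])
    qed
    moreover have "Z \<subseteq> fst G" using less.prems(2) X by blast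
    moreover have "normal G Z' S' \<and> tree_dec G k Z' S'" if "(Z', S') \<in> ?C" for Z' S'
      using that normal less.IH sub by blast
    ultimately show ?case using W(1)[OF less.prems(1)] by (intro tree_dec.node[where C = ?C]) auto
  qed
  obtain root where "root \<in> VT" and root: "\<forall>v\<in>VT. (root, v) \<in> ET\<^sup>*"
    using tree unfolding out_tree_def by blast
  have "{W r | r. r \<in> VT \<and> (root, r) \<in> ET\<^sup>*} = W ` VT" using root by auto
  then have "S root = fst G" using W(2) unfolding S_def by simp
  then show ?thesis using main[OF \<open>root \<in> VT\<close>, of "{}"] by simp
qed

section \<open>From path-decompositions to tree-decompositions on a path\<close>

text \<open>This is the covering relation of the order on \<open>I\<close>, that is, the directed
  path through \<open>I\<close> in increasing order.\<close>

definition consecutive :: "nat set \<Rightarrow> (nat \<times> nat) set" where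
  "consecutive I = {(i, j). i \<in> I \<and> j \<in> I \<and> i < j \<and> (\<forall>l\<in>I. l \<le> i \<or> j \<le> l)}"

text \<open>It turns the subtree below a node into a final segment of \<open>I\<close>. A node
  \<open>j\<close> above \<open>i\<close> is reached through its predecessor, the largest element of
  \<open>I\<close> below \<open>j\<close>.\<close>

lemma consecutive_rtrancl_iff:
  assumes "i \<in> I"
  shows "(i, j) \<in> (consecutive I)\<^sup>* \<longleftrightarrow> j \<in> I \<and> i \<le> j"
proof
  assume "(i, j) \<in> (consecutive I)\<^sup>*"
  then show "j \<in> I \<and> i \<le> j"
    using assms by (induction rule: rtrancl_induct) (auto simp: consecutive_def)
next
  show "(i, j) \<in> (consecutive I)\<^sup>*" if "j \<in> I \<and> i \<le> j"
    using that
  proof (induction j rule: less_induct)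
    case (less j)
    show ?case
    proof (cases "i = j")
      case False
      let ?P = "{l \<in> I. l < j}"
      have i: "i \<in> ?P" using assms less.prems False by simp
      have fin: "finite ?P" by simp
      have m: "Max ?P \<in> I" "Max ?P < j" "i \<le> Max ?P" using Max_in[OF fin] Max_ge[OF fin i] i by blast+
      have "l \<le> Max ?P \<or> j \<le> l" if "l \<in> I" for l using Max_ge[OF fin, of l] that by auto
      then have "(Max ?P, j) \<in> consecutive I" using m less.prems unfolding consecutive_def by blast
      then show ?thesis using less.IH[of "Max ?P"] m by (meson rtrancl.rtrancl_into_rtrancl)
    qed simp
  qed
qed

lemma out_tree_consecutive:
  assumes "finite I" "I \<noteq> {}"
  shows "out_tree I (consecutive I)"
proof -
  have m: "Min I \<in> I" "\<And>v. v \<in> I \<Longrightarrow> Min I \<le> v" using assms by auto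
  have "\<exists>!u. (u, v) \<in> consecutive I" if v: "v \<in> I" "v \<noteq> Min I" for v
  proof -
    have "(Min I, v) \<in> (consecutive I)\<^sup>*" using consecutive_rtrancl_iff[OF m(1)] v m(2) by blast
    then obtain u where u: "(u, v) \<in> consecutive I" using v(2) by (metis rtranclE)
    moreover have "u' = u" if "(u', v) \<in> consecutive I" for u'
    proof (rule antisym)
      show "u' \<le> u" "u \<le> u'" using u that unfolding consecutive_def by auto
    qed
    ultimately show ?thesis by blast
  qed
  moreover have "(u, Min I) \<notin> consecutive I" for u using m(2) unfolding consecutive_def by fastforce
  moreover have "consecutive I \<subseteq> I \<times> I" unfolding consecutive_def by blast
  moreover have "(Min I, v) \<in> (consecutive I)\<^sup>*" if "v \<in> I" for v
    using consecutive_rtrancl_iff[OF m(1)] m(2) that by blast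
  ultimately show ?thesis
    unfolding out_tree_def using assms(1) m(1) by (intro conjI bexI[of _ "Min I"]) simp_all
qed

text \<open>The tree is a path on the indices \<open>i\<close> such that some vertex occurs first in bag \<open>i\<close>.\<close>
lemma dtd_of_dpd:
  assumes dpd: "is_dpd G Xs" and G: "finite (fst G)" "fst G \<noteq> {}"
  obtains VT ET X W where "is_dtd G VT ET X W" "dtd_width VT ET X W \<le> dpd_width Xs"
proof -
  \<comment> \<open>The blocks collect vertices by first bag. \<open>I\<close> drops the indices
    with empty block, so the two bags meeting in a label need not be adjacent in
    \<open>Xs\<close>.\<close>
  define W where "W i = {v \<in> Xs ! i. \<forall>j<i. v \<notin> Xs ! j}" for i
  define I where "I = {i. i < length Xs \<and> W i \<noteq> {}}"
  define X where "X = (\<lambda>(i, j). Xs ! i \<inter> Xs ! j)"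
  have V: "(\<Union>i<length Xs. Xs ! i) = fst G"
    using is_dpd_bags[OF dpd] unfolding UN_nth .
  note arcs = is_dpd_arc[OF dpd] and consec = is_dpd_consec[OF dpd]
  have first: "\<exists>j\<in>I. j \<le> i \<and> v \<in> W j" if "i < length Xs" "v \<in> Xs ! i" for v i
  proof -
    define j where "j = (LEAST j. v \<in> Xs ! j)"
    have "v \<in> Xs ! j" "j \<le> i" using that(2) unfolding j_def by (auto intro: LeastI Least_le)
    moreover have "v \<notin> Xs ! l" if "l < j" for l using that not_less_Least unfolding j_def by blast
    ultimately have "j \<le> i" "v \<in> W j" unfolding W_def by auto
    then show ?thesis using that(1) unfolding I_def by (intro bexI[of _ j]) auto
  qed
  have WX: "W i \<subseteq> Xs ! i" for i unfolding W_def by blast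
  have cover: "(\<Union>i\<in>I. W i) = fst G"
  proof
    show "(\<Union>i\<in>I. W i) \<subseteq> fst G" using V WX unfolding I_def by blast
    show "fst G \<subseteq> (\<Union>i\<in>I. W i)" using V first by blast
  qed
  have I: "finite I" "I \<noteq> {}" using cover G(2) unfolding I_def by auto
  have disj: "W r \<inter> W s = {}" if "r \<noteq> s" for r s
    using that linorder_neq_iff[of r s] unfolding W_def by auto
  have normal: "normal G (X (i, j)) (\<Union>{W r | r. r \<in> I \<and> (j, r) \<in> (consecutive I)\<^sup>*})"
    if ij: "(i, j) \<in> consecutive I" for i j
  proof -
    have j: "i \<in> I" "j \<in> I" "i < j" "\<And>l. l \<in> I \<Longrightarrow> l \<le> i \<or> j \<le> l"
      using ij unfolding consecutive_def by auto
    let ?S = "\<Union>{W r | r. r \<in> I \<and> (j, r) \<in> (consecutive I)\<^sup>*}"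
    have S: "?S = (\<Union>r\<in>{r \<in> I. j \<le> r}. W r)" using consecutive_rtrancl_iff[OF j(2)] by blast
    \<comment> \<open>An arc can leave \<open>?S\<close> only into the label, so a walk that starts
      in \<open>?S\<close> and avoids the label stays in \<open>?S\<close>.\<close>
    have step: "v \<in> ?S" if uv: "(u, v) \<in> snd G" "u \<in> ?S" "v \<notin> X (i, j)" for u v
    proof -
      obtain a b where ab: "b < length Xs" "a \<le> b" "u \<in> Xs ! a" "v \<in> Xs ! b" using arcs uv(1) by blast
      obtain r where r: "r \<in> I" "j \<le> r" "u \<in> W r" using uv(2) unfolding S by blast
      have "r \<le> a" using ab(3) r(3) unfolding W_def by (intro leI notI) simp
      obtain c where c: "c \<in> I" "c \<le> b" "v \<in> W c" using first ab by blast
      \<comment> \<open>Otherwise \<open>c \<le> i < j \<le> r \<le> a \<le> b\<close>, and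
        \<open>v\<close>, being in bags \<open>c\<close> and \<open>b\<close>, would be in bags
        \<open>i\<close> and \<open>j\<close> and thus in the label.\<close>
      have "\<not> c \<le> i"
      proof
        assume "c \<le> i"
        then have "v \<in> Xs ! i" "v \<in> Xs ! j"
          using consec[of c i b v] consec[of c j b v] c WX ab \<open>r \<le> a\<close> r(2) j(3) by auto
        then show False using uv(3) unfolding X_def by simp
      qed
      then show ?thesis using c j(4) unfolding S by blast
    qed
    show ?thesis unfolding normal_def
    proof (rule notI, elim exE conjE bexE)
      fix w x
      assume w: "is_walk (snd G) w" "set w \<subseteq> fst G - X (i, j)" "hd w \<in> ?S"
        "x \<in> set w" "x \<notin> X (i, j) \<union> ?S"
      have "w ! n \<in> ?S" if "n < length w" for n
        using that
      proof (induction n)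
        case 0
        then show ?case using w(3) by (simp add: hd_conv_nth)
      next
        case (Suc n)
        then show ?case using w(1,2) step nth_mem[OF Suc.prems] unfolding is_walk_def
          by (meson DiffD2 Suc_lessD subsetD)
      qed
      moreover obtain n where "n < length w" "x = w ! n" using w(4) unfolding in_set_conv_nth by blast
      ultimately show False using w(5) by blast
    qed
  qed
  have XG: "X e \<subseteq> fst G" if "e \<in> consecutive I" for e
    using that V unfolding X_def consecutive_def I_def by auto
  have "is_dtd G I (consecutive I) X W"
    unfolding is_dtd_def
  proof (intro conjI ballI impI)
    show "out_tree I (consecutive I)" by (rule out_tree_consecutive[OF I])
    show "W r \<subseteq> fst G" if "r \<in> I" for r using cover that by blast
    show "W r \<noteq> {}" if "r \<in> I" for r using that unfolding I_def by blast
    show "case e of (i, j) \<Rightarrow> normal G (X (i, j)) (\<Union>{W r | r. r \<in> I \<and> (j, r) \<in> (consecutive I)\<^sup>*})"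
      if "e \<in> consecutive I" for e
      using normal that by (cases e) simp
  qed (use XG cover disj in auto)
  moreover have "dtd_width I (consecutive I) X W \<le> dpd_width Xs"
  proof -
    let ?B = "\<lambda>r. W r \<union> \<Union>{X e | e. e \<in> consecutive I \<and> (fst e = r \<or> snd e = r)}"
    have "card (?B r) \<le> Max (card ` set Xs)" if r: "r \<in> I" for r
    proof -
      have rl: "r < length Xs" using r unfolding I_def by simp
      then have "Xs ! r \<subseteq> fst G" using V by blast
      \<comment> \<open>Every label at \<open>r\<close> is an intersection with
        \<open>Xs ! r\<close>.\<close>
      moreover have "?B r \<subseteq> Xs ! r" using WX unfolding X_def by auto
      ultimately have "card (?B r) \<le> card (Xs ! r)" using G(1) card_mono finite_subset by meson
      also have "\<dots> \<le> Max (card ` set Xs)" using rl by (intro Max_ge) auto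
      finally show ?thesis .
    qed
    then have "Max ((\<lambda>r. card (?B r)) ` I) \<le> Max (card ` set Xs)" using I by (intro Max.boundedI) auto
    then show ?thesis unfolding dtd_width_def dpd_width_def by linarith
  qed
  ultimately show ?thesis using that by blast
qed

section \<open>Comparison of the two minima\<close>

theorem theorem5p6:
  fixes G :: "'a digraph"
  assumes "ext_dicograph G"
  shows "dpw G = dtw G"
proof (rule antisym)
  note wf = ext_dicograph_wf[OF assms]
  \<comment> \<open>The single bag \<open>fst G\<close> shows that the minimum defining
    \<open>dpw\<close> is attained.\<close>
  have "\<exists>w Xs. Xs \<noteq> [] \<and> is_dpd G Xs \<and> dpd_width Xs = w"
    using is_dpd_single wf by blast
  then have "\<exists>Xs. Xs \<noteq> [] \<and> is_dpd G Xs \<and> dpd_width Xs = dpw G"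
    unfolding dpw_def by (rule LeastI_ex)
  then obtain Xs where Xs: "is_dpd G Xs" "dpd_width Xs = dpw G" by blast
  obtain VT ET X W where T: "is_dtd G VT ET X W" "dtd_width VT ET X W \<le> dpw G"
    using dtd_of_dpd[OF Xs(1)] wf Xs(2) by metis
  have "dtw G \<le> dtd_width VT ET X W" unfolding dtw_def using T(1) by (intro Least_le) blast
  then show "dtw G \<le> dpw G" using T(2) by linarith
  \<comment> \<open>The decomposition just built shows that the minimum defining \<open>dtw\<close>
    is attained as well.\<close>
  have "\<exists>w VT ET X W. is_dtd G VT ET X W \<and> dtd_width VT ET X W = w" using T(1) by blast
  then have "\<exists>VT ET X W. is_dtd G VT ET X W \<and> dtd_width VT ET X W = dtw G"
    unfolding dtw_def by (rule LeastI_ex)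
  then obtain VT ET X W where T: "is_dtd G VT ET X W" "dtd_width VT ET X W = dtw G" by blast
  let ?b = "\<lambda>r. card (W r \<union> \<Union>{X e | e. e \<in> ET \<and> (fst e = r \<or> snd e = r)})"
  have "finite VT" using T(1) unfolding is_dtd_def out_tree_def by blast
  then have "?b r \<le> Max (?b ` VT)" if "r \<in> VT" for r using that by (intro Max_ge) auto
  \<comment> \<open>The bound is the largest bag size of an optimal tree-decomposition, so
    subtracting one gives \<open>dtw G\<close>.\<close>
  then have "tree_dec G (Max (?b ` VT)) {} (fst G)" using T(1) wf by (intro dtd_imp_tree_dec) auto
  then obtain Ys where Ys: "Ys \<noteq> []" "is_dpd G Ys" "\<forall>X\<in>set Ys. card X \<le> Max (?b ` VT)"
    using tree_dec_imp_dpd_bounded[OF assms] unfolding dpd_bounded_def by blast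
  have "dpw G \<le> dpd_width Ys" unfolding dpw_def using Ys(1,2) by (intro Least_le) blast
  also have "\<dots> \<le> Max (?b ` VT) - 1"
    using Ys(1,3) unfolding dpd_width_def by (intro diff_le_mono Max.boundedI) auto
  also have "\<dots> = dtw G" using T(2) unfolding dtd_width_def .
  finally show "dpw G \<le> dtw G" .
qed

end
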